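(* Let $H$ be a hypergraph with incidence graph $G_H$. The adjacency matrix $A_{G_H}$ has $0$ as an eigenvalue if and only if $H$ has at least one of the following: (1) a linearly dependent set of vertices; (2) a linearly dependent set of hyperedges.
   Context: A hypergraph $H=(V(H),E(H))$ consists of a finite non-empty vertex set $V(H)$ and a set $E(H)\subseteq\mathcal{P}(V(H))$ of hyperedges. The incidence matrix $I_H=[i_{ve}]_{v\in V(H),e\in E(H)}$ has $i_{ve}=1$ if $v\in e$ and $i_{ve}=0$ otherwise. For $v\in V(H)$ let $s_v:E(H)\to\{0,1\}$, $s_v(e)=i_{ve}$ (the $v$-th row); for $e\in E(H)$ let $\chi_e:V(H)\to\{0,1\}$, $\chi_e(v)=i_{ve}$ (the $e$-th column). A set $U\subseteq V(H)$ of vertices is linearly dependent if the family $(s_v)_{v\in U}$ (indexed by $U$) is linearly dependent; a set $E\subseteq E(H)$ of hyperedges is linearly dependent if $\{\chi_e:e\in E\}$ is linearly dependent. The incidence graph $G_H$ is the bipartite graph on the disjoint union $V(H)\sqcup E(H)$ in which $v\in V(H)$ and $e\in E(H)$ are adjacent iff $v\in e$; its adjacency matrix is $A_{G_H}=\begin{bmatrix}0&I_H\\ I_H^T&0\end{bmatrix}$. *)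

theory Defs
  imports
    Complex_Main
    "HOL-Library.Function_Algebras"
    "Jordan_Normal_Form.Char_Poly"
    "Graph_Theory.Pair_Digraph"
begin

locale hypergraph =
  fixes V :: "'a set" and E :: "'a set set"
  assumes finite_vertices: "finite V"
    and vertices_nonempty: "V \<noteq> {}"
    and edges_subset: "E \<subseteq> Pow V"

definition incidence :: "'a \<Rightarrow> 'a set \<Rightarrow> real" where
  "incidence v e = (if v \<in> e then 1 else 0)"

text \<open>
  The vector spaces of real functions on \<open>E\<close> and on \<open>V\<close> are represented by the total
  functions vanishing outside \<open>E\<close> and \<open>V\<close>, respectively.
\<close>

definition vertex_row :: "'a set set \<Rightarrow> 'a \<Rightarrow> 'a set \<Rightarrow> real" where
  "vertex_row E v = (\<lambda>e. if e \<in> E then incidence v e else 0)"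

definition edge_column :: "'a set \<Rightarrow> 'a set \<Rightarrow> 'a \<Rightarrow> real" where
  "edge_column V e = (\<lambda>v. if v \<in> V then incidence v e else 0)"

definition fun_scale :: "real \<Rightarrow> ('b \<Rightarrow> real) \<Rightarrow> 'b \<Rightarrow> real" where
  "fun_scale c f = (\<lambda>x. c * f x)"

interpretation real_fun: vector_space fun_scale
  by unfold_locales (auto simp: fun_scale_def fun_eq_iff algebra_simps)

text \<open>
  Linear dependence of an indexed family, so that a repeated vector makes the family dependent.
\<close>

definition family_dependent :: "'i set \<Rightarrow> ('i \<Rightarrow> 'b \<Rightarrow> real) \<Rightarrow> bool" where
  "family_dependent I f \<longleftrightarrow>
    (\<exists>J c. finite J \<and> J \<subseteq> I \<and> (\<Sum>i\<in>J. fun_scale (c i) (f i)) = 0 \<and> (\<exists>i\<in>J. c i \<noteq> 0))"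

definition vertices_dependent :: "'a set set \<Rightarrow> 'a set \<Rightarrow> bool" where
  "vertices_dependent E U \<longleftrightarrow> family_dependent U (vertex_row E)"

definition edges_dependent :: "'a set \<Rightarrow> 'a set set \<Rightarrow> bool" where
  "edges_dependent V F \<longleftrightarrow> real_fun.dependent (edge_column V ` F)"

text \<open>An undirected edge is represented by the two opposite arcs.\<close>

definition incidence_graph :: "'a set \<Rightarrow> 'a set set \<Rightarrow> ('a + 'a set) pair_pre_digraph" where
  "incidence_graph V E =
    \<lparr> pverts = V <+> E,
      parcs = {(Inl v, Inr e) | v e. v \<in> V \<and> e \<in> E \<and> v \<in> e} \<union>
              {(Inr e, Inl v) | v e. v \<in> V \<and> e \<in> E \<and> v \<in> e} \<rparr>"

text \<open>
  Matrices have rows and columns indexed by \<open>0, \<dots>, n - 1\<close>, so the adjacency matrix is formed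
  with respect to an enumeration \<open>ws\<close> of the vertices of the graph.
\<close>

definition vertex_enumeration :: "'v pair_pre_digraph \<Rightarrow> 'v list \<Rightarrow> bool" where
  "vertex_enumeration G ws \<longleftrightarrow> distinct ws \<and> set ws = pverts G"

definition adjacency_mat :: "'v pair_pre_digraph \<Rightarrow> 'v list \<Rightarrow> real mat" where
  "adjacency_mat G ws =
    mat (length ws) (length ws) (\<lambda>(i, j). if (ws ! i, ws ! j) \<in> parcs G then 1 else 0)"

lemma (in hypergraph) pair_graph_incidence_graph: "pair_graph (incidence_graph V E)"
proof -
  have fin: "finite E" using finite_vertices edges_subset by (simp add: finite_subset)
  have sub: "parcs (incidence_graph V E) \<subseteq> (V <+> E) \<times> (V <+> E)"
    by (auto simp: incidence_graph_def)
  have fin_arcs: "finite (parcs (incidence_graph V E))"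
    by (rule finite_subset[OF sub]) (simp add: fin finite_vertices)
  show ?thesis
    by unfold_locales
      (use sub fin_arcs fin finite_vertices in
        \<open>auto simp: incidence_graph_def arc_to_ends_def symmetric_def intro!: symI\<close>)
qed

lemma vertex_enumeration_incidence_graph:
  assumes "distinct vs" "set vs = V" "distinct es" "set es = E"
  shows "vertex_enumeration (incidence_graph V E) (map Inl vs @ map Inr es)"
  using assms by (auto simp: vertex_enumeration_def incidence_graph_def distinct_map)

text \<open>Listing \<open>V\<close> before \<open>E\<close> gives the usual block form.\<close>

lemma adjacency_mat_incidence_graph_block:
  assumes "set vs = V" and "set es = E"
  shows "adjacency_mat (incidence_graph V E) (map Inl vs @ map Inr es) =
    (let I = mat (length vs) (length es) (\<lambda>(i, j). incidence (vs ! i) (es ! j))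
     in four_block_mat (0\<^sub>m (length vs) (length vs)) I
          (transpose_mat I) (0\<^sub>m (length es) (length es)))"
proof -
  have e: "es ! (i - length vs) \<in> E"
    if "i < length vs + length es" "\<not> i < length vs" for i
    by (rule subst[OF assms(2)], rule nth_mem) (use that in linarith)
  have v: "vs ! i \<in> V" if "i < length vs" for i
    using that assms(1) by auto
  show ?thesis
    unfolding Let_def
    by (rule eq_matI)
      (auto simp: adjacency_mat_def incidence_graph_def incidence_def nth_append e v)
qed

end

theory Submission
  imports Defs
begin

text \<open>
  A real vector indexed by the vertices of the incidence graph is a pair: a weighting of \<open>V\<close> and a
  weighting of \<open>E\<close>. As the graph is bipartite, its adjacency matrix maps such a pair to zero
  exactly when each of the two weightings separately satisfies a linear system: the weights of the
  vertices of each hyperedge add up to zero, and the weights of the hyperedges at each vertex add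
  up to zero. These two systems say that the weights are the coefficients of a linear relation
  among the rows, respectively the columns, of the incidence matrix. A pair is nonzero iff one of
  its components is, so a null vector yields a nontrivial relation among the rows or among the
  columns; conversely, a nontrivial relation of either kind, extended by zero to the other side,
  is a null vector.

  Two points need care. A null vector lives on an enumeration of the graph while a relation is a
  sum over a set; \<open>eigenvalue_zero_adjacency_mat_iff\<close> passes from one to the other. Moreover,
  dependence of hyperedges concerns a set of columns instead of an indexed family; this makes no
  difference because distinct hyperedges have distinct columns (\<open>inj_on_edge_column\<close>).
\<close>

section \<open>Null vectors of an adjacency matrix\<close>

lemma adjacency_mat_mult_vec_nth:
  assumes "distinct ws" "i < length ws"
  shows "(adjacency_mat G ws *\<^sub>v vec (length ws) (\<lambda>j. x (ws ! j))) $ i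
    = (\<Sum>u\<in>{u \<in> set ws. (ws ! i, u) \<in> parcs G}. x u)"
proof -
  have "(adjacency_mat G ws *\<^sub>v vec (length ws) (\<lambda>j. x (ws ! j))) $ i
      = (\<Sum>j<length ws. if (ws ! i, ws ! j) \<in> parcs G then x (ws ! j) else 0)"
    using assms(2)
    by (auto simp: adjacency_mat_def scalar_prod_def atLeast0LessThan intro!: sum.cong)
  also have "\<dots> = (\<Sum>u\<in>set ws. if (ws ! i, u) \<in> parcs G then x u else 0)"
    by (rule sum.reindex_bij_betw[OF bij_betw_nth[OF assms(1) refl refl]])
  also have "\<dots> = (\<Sum>u\<in>{u \<in> set ws. (ws ! i, u) \<in> parcs G}. x u)"
    by (simp add: sum.inter_filter)
  finally show ?thesis .
qed

text \<open>
  This describes null vectors without reference to the order of the enumeration: they are the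
  nonzero weightings for which the successors of every vertex have total weight zero.
\<close>

lemma eigenvalue_zero_adjacency_mat_iff:
  assumes "distinct ws"
  shows "eigenvalue (adjacency_mat G ws) 0 \<longleftrightarrow>
    (\<exists>x. (\<exists>w\<in>set ws. x w \<noteq> 0) \<and>
      (\<forall>w\<in>set ws. (\<Sum>u\<in>{u \<in> set ws. (w, u) \<in> parcs G}. x u) = (0::real)))"
    (is "_ \<longleftrightarrow> (\<exists>x. ?null x)")
proof -
  let ?n = "length ws" and ?A = "adjacency_mat G ws"
  let ?vec = "\<lambda>x. vec ?n (\<lambda>j. x (ws ! j)) :: real vec"
  have dim: "dim_row ?A = ?n" by (simp add: adjacency_mat_def)
  have bex_nth: "(\<exists>w\<in>set ws. P w) \<longleftrightarrow> (\<exists>j<?n. P (ws ! j))" for P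
    by (metis in_set_conv_nth)
  have null_iff: "eigenvector ?A (?vec x) 0 \<longleftrightarrow> ?null x" for x
  proof -
    have "eigenvector ?A (?vec x) 0 \<longleftrightarrow>
        (\<exists>j<?n. x (ws ! j) \<noteq> 0) \<and> (\<forall>i<?n. (?A *\<^sub>v ?vec x) $ i = 0)"
      by (auto simp: eigenvector_def dim vec_eq_iff simp del: index_mult_mat_vec)
    also have "\<dots> \<longleftrightarrow> (\<exists>j<?n. x (ws ! j) \<noteq> 0) \<and>
        (\<forall>i<?n. (\<Sum>u\<in>{u \<in> set ws. (ws ! i, u) \<in> parcs G}. x u) = 0)"
      by (simp add: adjacency_mat_mult_vec_nth[OF assms] del: index_mult_mat_vec)
    also have "\<dots> \<longleftrightarrow> ?null x"
      by (simp only: all_set_conv_all_nth bex_nth)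
    finally show ?thesis .
  qed
  show ?thesis
  proof
    assume "eigenvalue ?A 0"
    then obtain v where v: "eigenvector ?A v 0" by (auto simp: eigenvalue_def)
    (* The weight of a vertex is the coordinate of v at its position in the enumeration. *)
    let ?x = "\<lambda>w. v $ the_inv_into {..<?n} ((!) ws) w"
    have "v = ?vec ?x"
      using v inj_on_nth[OF assms, of "{..<?n}"]
      by (auto simp: eigenvector_def dim the_inv_into_f_f)
    with v null_iff[of ?x] show "\<exists>x. ?null x" by auto
  next
    assume "\<exists>x. ?null x"
    then show "eigenvalue ?A 0" using null_iff by (auto simp: eigenvalue_def)
  qed
qed

section \<open>Linear relations among rows and among columns\<close>

lemma sum_fun_scale_apply:
  "(\<Sum>i\<in>J. fun_scale (c i) (f i)) x = (\<Sum>i\<in>J. c i * f i x)"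
  by (induction J rule: infinite_finite_induct) (auto simp: fun_scale_def)

lemma family_dependent_mono:
  "family_dependent J f \<Longrightarrow> J \<subseteq> I \<Longrightarrow> family_dependent I f"
  unfolding family_dependent_def by (meson subset_trans)

text \<open>
  Over a finite index set a relation among some members becomes one among all members when the
  missing coefficients are set to zero.
\<close>

lemma family_dependent_finite_iff:
  assumes "finite I"
  shows "family_dependent I f \<longleftrightarrow>
    (\<exists>c. (\<exists>i\<in>I. c i \<noteq> 0) \<and> (\<forall>x. (\<Sum>i\<in>I. c i * f i x) = 0))"
proof
  assume "family_dependent I f"
  then obtain J c where J: "J \<subseteq> I" and rel: "(\<Sum>i\<in>J. fun_scale (c i) (f i)) = 0"
    and nz: "\<exists>i\<in>J. c i \<noteq> 0"
    unfolding family_dependent_def by blast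
  let ?c = "\<lambda>i. if i \<in> J then c i else 0"
  have "(\<Sum>i\<in>I. ?c i * f i x) = 0" for x
  proof -
    have "(\<Sum>i\<in>I. ?c i * f i x) = (\<Sum>i\<in>J. c i * f i x)"
      by (rule sum.mono_neutral_cong_right) (use assms J in auto)
    also have "\<dots> = 0" using fun_cong[OF rel, of x] by (simp add: sum_fun_scale_apply)
    finally show ?thesis .
  qed
  moreover have "\<exists>i\<in>I. ?c i \<noteq> 0" using J nz by auto
  ultimately show "\<exists>c. (\<exists>i\<in>I. c i \<noteq> 0) \<and> (\<forall>x. (\<Sum>i\<in>I. c i * f i x) = 0)"
    by (intro exI[of _ ?c] conjI allI)
next
  assume "\<exists>c. (\<exists>i\<in>I. c i \<noteq> 0) \<and> (\<forall>x. (\<Sum>i\<in>I. c i * f i x) = 0)"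
  then obtain c where "\<exists>i\<in>I. c i \<noteq> 0" "\<forall>x. (\<Sum>i\<in>I. c i * f i x) = 0" by blast
  moreover from this have "(\<Sum>i\<in>I. fun_scale (c i) (f i)) = 0"
    by (simp add: fun_eq_iff sum_fun_scale_apply)
  ultimately show "family_dependent I f" using assms by (auto simp: family_dependent_def)
qed

text \<open>
  For an injective family, relations among its members and relations among the vectors in its
  image correspond to each other by relabelling the coefficients.
\<close>

lemma dependent_image_iff_family_dependent:
  assumes "inj_on f I"
  shows "real_fun.dependent (f ` I) \<longleftrightarrow> family_dependent I f"
proof
  assume "real_fun.dependent (f ` I)"
  then obtain T c where T: "finite T" "T \<subseteq> f ` I"
    and rel: "(\<Sum>g\<in>T. fun_scale (c g) g) = 0" and nz: "\<exists>g\<in>T. c g \<noteq> 0"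
    unfolding real_fun.dependent_explicit by blast
  obtain J where J: "J \<subseteq> I" "T = f ` J" using T(2) by (auto simp: subset_image_iff)
  have inj: "inj_on f J" using assms J(1) by (rule inj_on_subset)
  have "finite J" using T(1) inj J(2) by (simp add: finite_image_iff)
  moreover have "(\<Sum>i\<in>J. fun_scale (c (f i)) (f i)) = 0"
    using rel by (simp add: J(2) sum.reindex[OF inj])
  ultimately show "family_dependent I f"
    using J nz unfolding family_dependent_def by (intro exI[of _ J] exI[of _ "c \<circ> f"]) auto
next
  assume "family_dependent I f"
  then obtain J c where J: "finite J" "J \<subseteq> I"
    and rel: "(\<Sum>i\<in>J. fun_scale (c i) (f i)) = 0" and nz: "\<exists>i\<in>J. c i \<noteq> 0"
    unfolding family_dependent_def by blast
  have inj: "inj_on f J" using assms J(2) by (rule inj_on_subset)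
  let ?c = "c \<circ> the_inv_into J f"
  have "(\<Sum>g\<in>f ` J. fun_scale (?c g) g) = 0"
    using rel by (simp add: sum.reindex[OF inj] the_inv_into_f_f[OF inj])
  moreover have "\<exists>g\<in>f ` J. ?c g \<noteq> 0" using nz by (auto simp: the_inv_into_f_f[OF inj])
  ultimately show "real_fun.dependent (f ` I)"
    using J unfolding real_fun.dependent_explicit
    by (intro exI[of _ "f ` J"] exI[of _ ?c]) auto
qed

section \<open>Dependence in a hypergraph\<close>

context hypergraph
begin

lemma finite_edges: "finite E"
  using finite_vertices edges_subset by (simp add: finite_subset)

lemma inj_on_edge_column: "inj_on (edge_column V) E"
proof (rule inj_onI)
  fix e e' assume "e \<in> E" "e' \<in> E" "edge_column V e = edge_column V e'"
  then have "edge_column V e v = edge_column V e' v" for v by simp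
  then have "v \<in> e \<longleftrightarrow> v \<in> e'" if "v \<in> V" for v
    using that by (metis edge_column_def incidence_def zero_neq_one)
  with \<open>e \<in> E\<close> \<open>e' \<in> E\<close> edges_subset show "e = e'" by blast
qed

text \<open>
  Dependence passes to larger sets, so it suffices to decide whether all of \<open>V\<close> is dependent. A row
  vanishes outside \<open>E\<close>, so a relation among rows imposes one equation for each hyperedge. The same
  reasoning applies to the columns.
\<close>

lemma ex_vertices_dependent_iff:
  "(\<exists>U\<subseteq>V. vertices_dependent E U) \<longleftrightarrow>
    (\<exists>y. (\<exists>v\<in>V. y v \<noteq> 0) \<and> (\<forall>e\<in>E. (\<Sum>v\<in>{v \<in> V. v \<in> e}. y v) = (0::real)))"
proof -
  have entry: "(\<Sum>v\<in>V. y v * vertex_row E v e) = (if e \<in> E then \<Sum>v\<in>{v \<in> V. v \<in> e}. y v else 0)"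
    for y e
    using finite_vertices
    by (auto simp: vertex_row_def incidence_def sum.inter_filter intro!: sum.cong)
  have "(\<exists>U\<subseteq>V. vertices_dependent E U) \<longleftrightarrow> family_dependent V (vertex_row E)"
    using family_dependent_mono unfolding vertices_dependent_def by blast
  also have "\<dots> \<longleftrightarrow> (\<exists>y. (\<exists>v\<in>V. y v \<noteq> 0) \<and> (\<forall>e. (\<Sum>v\<in>V. y v * vertex_row E v e) = 0))"
    by (rule family_dependent_finite_iff[OF finite_vertices])
  finally show ?thesis by (simp add: entry Ball_def)
qed

lemma ex_edges_dependent_iff:
  "(\<exists>F\<subseteq>E. edges_dependent V F) \<longleftrightarrow>
    (\<exists>z. (\<exists>e\<in>E. z e \<noteq> 0) \<and> (\<forall>v\<in>V. (\<Sum>e\<in>{e \<in> E. v \<in> e}. z e) = (0::real)))"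
proof -
  have entry: "(\<Sum>e\<in>E. z e * edge_column V e v) = (if v \<in> V then \<Sum>e\<in>{e \<in> E. v \<in> e}. z e else 0)"
    for z v
    using finite_edges
    by (auto simp: edge_column_def incidence_def sum.inter_filter intro!: sum.cong)
  have "edges_dependent V F \<longleftrightarrow> family_dependent F (edge_column V)" if "F \<subseteq> E" for F
    unfolding edges_dependent_def
    by (rule dependent_image_iff_family_dependent[OF inj_on_subset[OF inj_on_edge_column that]])
  then have "(\<exists>F\<subseteq>E. edges_dependent V F) \<longleftrightarrow> family_dependent E (edge_column V)"
    using family_dependent_mono by blast
  also have "\<dots> \<longleftrightarrow> (\<exists>z. (\<exists>e\<in>E. z e \<noteq> 0) \<and> (\<forall>v. (\<Sum>e\<in>E. z e * edge_column V e v) = 0))"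
    by (rule family_dependent_finite_iff[OF finite_edges])
  finally show ?thesis by (simp add: entry Ball_def)
qed

end

section \<open>Singularity of the incidence graph\<close>

lemma sum_neighbours_Inl:
  assumes "v \<in> V"
  shows "(\<Sum>u\<in>{u \<in> V <+> E. (Inl v, u) \<in> parcs (incidence_graph V E)}. x u)
    = (\<Sum>e\<in>{e \<in> E. v \<in> e}. x (Inr e))"
proof -
  have "{u \<in> V <+> E. (Inl v, u) \<in> parcs (incidence_graph V E)} = Inr ` {e \<in> E. v \<in> e}"
    using assms by (auto simp: incidence_graph_def)
  then show ?thesis by (simp add: sum.reindex)
qed

lemma sum_neighbours_Inr:
  assumes "e \<in> E"
  shows "(\<Sum>u\<in>{u \<in> V <+> E. (Inr e, u) \<in> parcs (incidence_graph V E)}. x u)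
    = (\<Sum>v\<in>{v \<in> V. v \<in> e}. x (Inl v))"
proof -
  have "{u \<in> V <+> E. (Inr e, u) \<in> parcs (incidence_graph V E)} = Inl ` {v \<in> V. v \<in> e}"
    using assms by (auto simp: incidence_graph_def)
  then show ?thesis by (simp add: sum.reindex)
qed

theorem theorem2p5:
  fixes V :: "'a set" and E :: "'a set set" and ws :: "('a + 'a set) list"
  assumes "hypergraph V E"
    and "vertex_enumeration (incidence_graph V E) ws"
  shows "eigenvalue (adjacency_mat (incidence_graph V E) ws) 0 \<longleftrightarrow>
    (\<exists>U\<subseteq>V. vertices_dependent E U) \<or> (\<exists>F\<subseteq>E. edges_dependent V F)"
proof -
  interpret hypergraph V E by (rule assms(1))
  let ?rows = "\<lambda>y. \<forall>e\<in>E. (\<Sum>v\<in>{v \<in> V. v \<in> e}. y v) = (0::real)"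
  let ?cols = "\<lambda>z. \<forall>v\<in>V. (\<Sum>e\<in>{e \<in> E. v \<in> e}. z e) = (0::real)"
  let ?null = "\<lambda>x. ((\<exists>v\<in>V. x (Inl v) \<noteq> 0) \<or> (\<exists>e\<in>E. x (Inr e) \<noteq> 0)) \<and>
    ?cols (\<lambda>e. x (Inr e)) \<and> ?rows (\<lambda>v. x (Inl v))"
  have ws: "distinct ws" "set ws = V <+> E"
    using assms(2) by (auto simp: vertex_enumeration_def incidence_graph_def)
  have Ball_Plus: "(\<forall>w\<in>V <+> E. P w) \<longleftrightarrow> (\<forall>v\<in>V. P (Inl v)) \<and> (\<forall>e\<in>E. P (Inr e))" for P
    by auto
  have Bex_Plus: "(\<exists>w\<in>V <+> E. P w) \<longleftrightarrow> (\<exists>v\<in>V. P (Inl v)) \<or> (\<exists>e\<in>E. P (Inr e))" for P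
    by auto
  have "eigenvalue (adjacency_mat (incidence_graph V E) ws) 0 \<longleftrightarrow> (\<exists>x. ?null x)"
    unfolding eigenvalue_zero_adjacency_mat_iff[OF ws(1)] ws(2) Ball_Plus Bex_Plus
    by (simp add: sum_neighbours_Inl sum_neighbours_Inr cong: ball_cong)
  also have "\<dots> \<longleftrightarrow>
    (\<exists>y. (\<exists>v\<in>V. y v \<noteq> 0) \<and> ?rows y) \<or> (\<exists>z. (\<exists>e\<in>E. z e \<noteq> 0) \<and> ?cols z)"
    (is "_ \<longleftrightarrow> ?row_relation \<or> ?col_relation")
  proof
    assume "\<exists>x. ?null x"
    then obtain x where x: "?null x" by (rule exE)
    from x have "(\<exists>v\<in>V. x (Inl v) \<noteq> 0) \<or> (\<exists>e\<in>E. x (Inr e) \<noteq> 0)" by (rule conjunct1)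
    then show "?row_relation \<or> ?col_relation"
    proof
      assume "\<exists>v\<in>V. x (Inl v) \<noteq> 0"
      with x show ?thesis by (intro disjI1 exI[of _ "\<lambda>v. x (Inl v)"] conjI) simp_all
    next
      assume "\<exists>e\<in>E. x (Inr e) \<noteq> 0"
      with x show ?thesis by (intro disjI2 exI[of _ "\<lambda>e. x (Inr e)"] conjI) simp_all
    qed
  next
    assume "?row_relation \<or> ?col_relation"
    then show "\<exists>x. ?null x"
    proof
      assume ?row_relation
      then obtain y where "(\<exists>v\<in>V. y v \<noteq> 0) \<and> ?rows y" by blast
      then have "?null (case_sum y (\<lambda>_. 0))" by simp
      then show ?thesis by (intro exI[of _ "case_sum y (\<lambda>_. 0)"])
    next
      assume ?col_relation
      then obtain z where "(\<exists>e\<in>E. z e \<noteq> 0) \<and> ?cols z" by blast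
      then have "?null (case_sum (\<lambda>_. 0) z)" by simp
      then show ?thesis by (intro exI[of _ "case_sum (\<lambda>_. 0) z"])
    qed
  qed
  finally show ?thesis unfolding ex_vertices_dependent_iff ex_edges_dependent_iff .
qed

end
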